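(* Let $H$ be an infinite-dimensional separable complex Hilbert space and let $T\in\mathcal{B}(H)$. Then: (i) $|T|\in\mathcal{M}_r(H)$ if and only if $T^*T\in\mathcal{M}_r(H)$; (ii) if $|T|\in\mathcal{M}_r(H)$, then $T\in\mathcal{M}_r(H)$; (iii) if $T$ is positive, then $T\in\mathcal{M}_r(H)$ if and only if $T^2\in\mathcal{M}_r(H)$.
   Context: $\mathcal{B}(H)$ denotes the bounded linear operators on $H$; $|T|=(T^*T)^{1/2}$. For a nonzero Hilbert space $M$ and $A\in\mathcal{B}(M)$, the minimum modulus is $m(A)=\inf\{\|Ax\|: x\in M,\ \|x\|=1\}$; $A$ is minimum attaining if there is a unit vector $x_0\in M$ with $\|Ax_0\|=m(A)$. A closed subspace $M\subseteq H$ reduces $T\in\mathcal{B}(H)$ if $T(M)\subseteq M$ and $T^*(M)\subseteq M$. $\mathcal{M}_r(H)$ is the set of all $T\in\mathcal{B}(H)$ such that for every nonzero closed subspace $M$ reducing $T$, the restriction $T|_M:M\to M$ is minimum attaining. *)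

theory Defs
  imports "HOL-Analysis.Analysis"
begin

text \<open>
  Complex Hilbert spaces, as a type class on top of the real normed spaces of the library.
  The real scalar multiplication, the norm, the metric and the topology are those of the library,
  tied to the complex structure by \<open>scaleR_scaleC\<close> and \<open>norm_eq_sqrt_cinner\<close>.
  The inner product is linear in the first argument and conjugate-linear in the second.
\<close>

class complex_inner = real_normed_vector +
  fixes scaleC :: "complex \<Rightarrow> 'a \<Rightarrow> 'a" (infixr "*\<^sub>C" 75)
    and cinner :: "'a \<Rightarrow> 'a \<Rightarrow> complex"
  assumes scaleC_add_right: "a *\<^sub>C (x + y) = a *\<^sub>C x + a *\<^sub>C y"
    and scaleC_add_left: "(a + b) *\<^sub>C x = a *\<^sub>C x + b *\<^sub>C x"
    and scaleC_scaleC: "a *\<^sub>C (b *\<^sub>C x) = (a * b) *\<^sub>C x"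
    and scaleC_one: "1 *\<^sub>C x = x"
    and scaleR_scaleC: "r *\<^sub>R x = complex_of_real r *\<^sub>C x"
    and cinner_commute: "cinner x y = cnj (cinner y x)"
    and cinner_add_left: "cinner (x + y) z = cinner x z + cinner y z"
    and cinner_scaleC_left: "cinner (a *\<^sub>C x) y = a * cinner x y"
    and cinner_self_nonneg: "cinner x x \<in> \<real>\<^sub>\<ge>\<^sub>0"
    and cinner_self_eq_zero_iff: "cinner x x = 0 \<longleftrightarrow> x = 0"
    and norm_eq_sqrt_cinner: "norm x = sqrt (Re (cinner x x))"

class complex_hilbert = complex_inner + complete_space

global_interpretation complex_vector: vector_space "scaleC :: complex \<Rightarrow> 'a \<Rightarrow> 'a::complex_inner"
  defines csubspace = complex_vector.subspace
    and cspan = complex_vector.span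
  by unfold_locales
    (simp_all add: scaleC_add_right scaleC_add_left scaleC_scaleC scaleC_one)

definition infinite_dimensional :: "'a::complex_inner itself \<Rightarrow> bool" where
  "infinite_dimensional _ \<longleftrightarrow> \<not> (\<exists>B::'a set. finite B \<and> cspan B = UNIV)"

definition bounded_clinear :: "('a::complex_inner \<Rightarrow> 'a) \<Rightarrow> bool" where
  "bounded_clinear T \<longleftrightarrow> bounded_linear T \<and> (\<forall>a x. T (a *\<^sub>C x) = a *\<^sub>C T x)"

text \<open>
  The definite descriptions in \<open>cadjoint\<close> and \<open>op_sqrt\<close> are meaningful for bounded operators,
  respectively bounded positive operators, on a complex Hilbert space.
\<close>

definition cadjoint :: "('a::complex_hilbert \<Rightarrow> 'a) \<Rightarrow> 'a \<Rightarrow> 'a" where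
  "cadjoint T = (THE S. bounded_clinear S \<and> (\<forall>x y. cinner (T x) y = cinner x (S y)))"

definition positive_op :: "('a::complex_hilbert \<Rightarrow> 'a) \<Rightarrow> bool" where
  "positive_op A \<longleftrightarrow> bounded_clinear A \<and> (\<forall>x. cinner (A x) x \<in> \<real>\<^sub>\<ge>\<^sub>0)"

definition op_sqrt :: "('a::complex_hilbert \<Rightarrow> 'a) \<Rightarrow> 'a \<Rightarrow> 'a" where
  "op_sqrt A = (THE B. positive_op B \<and> B \<circ> B = A)"

definition op_abs :: "('a::complex_hilbert \<Rightarrow> 'a) \<Rightarrow> 'a \<Rightarrow> 'a" where
  "op_abs T = op_sqrt (cadjoint T \<circ> T)"

text \<open>
  The restriction of an operator to a closed subspace is represented by the operator together
  with the subspace \<open>M\<close>.  The notions on \<open>M\<close> are intended for \<open>M \<noteq> {0}\<close> only: otherwise the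
  infimum is over the empty set.
\<close>

definition min_modulus_on :: "'a::complex_hilbert set \<Rightarrow> ('a \<Rightarrow> 'a) \<Rightarrow> real" where
  "min_modulus_on M A = Inf {norm (A x) | x. x \<in> M \<and> norm x = 1}"

definition minimum_attaining_on :: "'a::complex_hilbert set \<Rightarrow> ('a \<Rightarrow> 'a) \<Rightarrow> bool" where
  "minimum_attaining_on M A \<longleftrightarrow> (\<exists>x\<in>M. norm x = 1 \<and> norm (A x) = min_modulus_on M A)"

definition reduces :: "'a::complex_hilbert set \<Rightarrow> ('a \<Rightarrow> 'a) \<Rightarrow> bool" where
  "reduces M T \<longleftrightarrow> csubspace M \<and> closed M \<and> T ` M \<subseteq> M \<and> cadjoint T ` M \<subseteq> M"

definition min_attaining_reducing :: "('a::complex_hilbert \<Rightarrow> 'a) set" ("\<M>\<^sub>r") where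
  "\<M>\<^sub>r = {T. bounded_clinear T \<and>
         (\<forall>M. reduces M T \<and> M \<noteq> {0} \<longrightarrow> minimum_attaining_on M T)}"

end

theory Submission
  imports Defs
begin

text \<open>
  Everything reduces to a positive operator \<open>P\<close> and its square. A closed subspace invariant under
  \<open>P\<^sup>2\<close> is invariant under \<open>P\<close>, the unique positive square root of \<open>P\<^sup>2\<close>, which is a limit of
  polynomials in \<open>P\<^sup>2\<close>; so \<open>P\<close> and \<open>P\<^sup>2\<close> have the same reducing subspaces. Let \<open>m\<close> be the minimum
  modulus of \<open>P\<close> on such a subspace. There \<open>R = P\<^sup>2 - m\<^sup>2\<close> is a nonnegative form with
  \<open>\<parallel>R x\<parallel>\<^sup>2 \<le> K (\<parallel>P x\<parallel>\<^sup>2 - m\<^sup>2)\<close> on unit vectors, so \<open>P\<^sup>2\<close> has minimum modulus \<open>m\<^sup>2\<close>, attained where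
  \<open>P\<close> attains \<open>m\<close>; the converse follows from \<open>m \<parallel>P x\<parallel> \<le> \<parallel>P\<^sup>2 x\<parallel>\<close>. Finally \<open>\<parallel>|T| x\<parallel> = \<parallel>T x\<parallel>\<close>, and
  subspaces reducing \<open>T\<close> reduce \<open>|T|\<^sup>2\<close>, hence \<open>|T|\<close>.
\<close>

\<comment> \<open>Makes the bounded real-linear operators on the space a Banach space, in which the
  iteration for square roots converges.\<close>
subclass (in complex_hilbert) banach ..

section \<open>Inner product algebra and the Cauchy-Schwarz inequality\<close>

lemma cinner_add_right: "cinner x (y + z) = cinner x y + cinner x (z::'a::complex_inner)"
  by (metis cinner_commute cinner_add_left complex_cnj_add)

lemma cinner_scaleC_right: "cinner x (a *\<^sub>C y) = cnj a * cinner x (y::'a::complex_inner)"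
  by (metis cinner_commute cinner_scaleC_left complex_cnj_mult)

lemma cinner_scaleR_left: "cinner (r *\<^sub>R x) y = r * cinner x (y::'a::complex_inner)"
  by (simp add: scaleR_scaleC cinner_scaleC_left)

lemma cinner_scaleR_right: "cinner x (r *\<^sub>R y) = r * cinner x (y::'a::complex_inner)"
  by (simp add: scaleR_scaleC cinner_scaleC_right)

lemma cinner_zero [simp]: "cinner 0 x = 0" "cinner x 0 = 0" for x :: "'a::complex_inner"
  using cinner_scaleR_left[of 0 x x] cinner_scaleR_right[of x 0 x] by simp_all

lemma cinner_minus_left: "cinner (- x) y = - cinner x (y::'a::complex_inner)"
  using cinner_scaleR_left[of "-1" x y] by simp

lemma cinner_minus_right: "cinner x (- y) = - cinner x (y::'a::complex_inner)"
  using cinner_scaleR_right[of x "-1" y] by simp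

lemma cinner_diff_left: "cinner (x - y) z = cinner x z - cinner y (z::'a::complex_inner)"
  using cinner_add_left[of x "- y" z] by (simp add: cinner_minus_left)

lemma cinner_diff_right: "cinner x (y - z) = cinner x y - cinner x (z::'a::complex_inner)"
  using cinner_add_right[of x y "- z"] by (simp add: cinner_minus_right)

lemmas cinner_linear =
  cinner_add_left cinner_add_right cinner_diff_left cinner_diff_right
  cinner_scaleR_left cinner_scaleR_right cinner_minus_left cinner_minus_right

lemma Re_cinner_commute: "Re (cinner x y) = Re (cinner y (x::'a::complex_inner))"
  by (subst cinner_commute) simp

lemma Re_cinner_self: "Re (cinner x x) = (norm (x::'a::complex_inner))\<^sup>2"
  using cinner_self_nonneg[of x] norm_eq_sqrt_cinner[of x]
  by (simp add: complex_nonneg_Reals_iff)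

lemma cinner_self: "cinner x x = complex_of_real ((norm (x::'a::complex_inner))\<^sup>2)"
  using cinner_self_nonneg[of x] Re_cinner_self[of x]
  by (simp add: complex_nonneg_Reals_iff complex_eq_iff)

lemma norm_scaleC: "norm (a *\<^sub>C x) = cmod a * norm (x::'a::complex_inner)"
proof -
  have "cinner (a *\<^sub>C x) (a *\<^sub>C x) = (a * cnj a) * cinner x x"
    by (simp add: cinner_scaleC_left cinner_scaleC_right)
  also have "\<dots> = complex_of_real ((cmod a * norm x)\<^sup>2)"
    unfolding complex_norm_square[symmetric] cinner_self by (simp add: power_mult_distrib)
  finally show ?thesis
    using norm_eq_sqrt_cinner[of "a *\<^sub>C x"] by simp
qed

lemma norm_add_square:
  "(norm (x + y :: 'a::complex_inner))\<^sup>2 = (norm x)\<^sup>2 + 2 * Re (cinner x y) + (norm y)\<^sup>2"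
  using Re_cinner_commute[of x y]
  by (simp add: Re_cinner_self[symmetric] cinner_linear)

lemma norm_diff_square:
  "(norm (x - y :: 'a::complex_inner))\<^sup>2 = (norm x)\<^sup>2 - 2 * Re (cinner x y) + (norm y)\<^sup>2"
  using Re_cinner_commute[of x y]
  by (simp add: Re_cinner_self[symmetric] cinner_linear)

lemma Re_cinner_le: "Re (cinner x y) \<le> norm x * norm (y::'a::complex_inner)"
proof (cases "x = 0 \<or> y = 0")
  case True
  then show ?thesis by auto
next
  case False
  then have pos: "0 < norm x * norm y" by simp
  \<comment> \<open>The weights give both vectors the norm \<open>norm x * norm y\<close>, so the
    expanded square factors and its positive factor cancels.\<close>
  have "0 \<le> (norm (norm y *\<^sub>R x - norm x *\<^sub>R y))\<^sup>2" by simp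
  also have "\<dots> = 2 * (norm x * norm y) * (norm x * norm y - Re (cinner x y))"
    unfolding norm_diff_square by (simp add: cinner_linear power2_eq_square algebra_simps)
  finally show ?thesis
    using pos by (simp add: zero_le_mult_iff)
qed

lemma norm_cinner_le: "cmod (cinner x y) \<le> norm x * norm (y::'a::complex_inner)"
proof (cases "cinner x y = 0")
  case False
  \<comment> \<open>The phase \<open>a\<close> rotates the inner product onto the positive real
    axis, where the bound on the real part bounds the modulus.\<close>
  define a where "a = cnj (cinner x y) / cmod (cinner x y)"
  have a: "cmod a = 1" using False by (simp add: a_def norm_divide)
  have "cinner (a *\<^sub>C x) y = cmod (cinner x y)"
    using False complex_norm_square[of "cinner x y"]
    by (simp add: a_def cinner_scaleC_left field_simps power2_eq_square)
  then show ?thesis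
    using Re_cinner_le[of "a *\<^sub>C x" y] a by (simp add: norm_scaleC)
qed simp

lemma bounded_bilinear_cinner: "bounded_bilinear (cinner :: 'a::complex_inner \<Rightarrow> 'a \<Rightarrow> complex)"
proof
  show "\<exists>K. \<forall>a b::'a. cmod (cinner a b) \<le> norm a * norm b * K"
    using norm_cinner_le by (metis mult.right_neutral)
qed (auto simp: cinner_linear scaleR_conv_of_real)

lemmas continuous_on_cinner [continuous_intros] =
  bounded_bilinear.continuous_on[OF bounded_bilinear_cinner]

text \<open>Recovering the imaginary part from the real part at \<open>\<i> *\<^sub>C x\<close>
  lifts the real Riesz theorem to complex inner products.\<close>

lemma cinner_eq_Re:
  "cinner x y = Complex (Re (cinner x y)) (- Re (cinner (\<i> *\<^sub>C x) (y::'a::complex_inner)))"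
  by (simp add: cinner_scaleC_left complex_eq_iff)

lemma bounded_linear_scaleC: "bounded_linear (\<lambda>x::'a::complex_inner. a *\<^sub>C x)"
proof (rule bounded_linear_intro)
  show "norm (a *\<^sub>C x) \<le> norm x * cmod a" for x :: 'a
    by (simp add: norm_scaleC)
qed (simp_all add: scaleC_add_right scaleR_scaleC mult.commute)

lemma csubspace_scaleR:
  assumes "csubspace M" "x \<in> M"
  shows "r *\<^sub>R (x::'a::complex_inner) \<in> M"
  using assms by (simp add: scaleR_scaleC complex_vector.subspace_scale)

section \<open>Adjoints\<close>

text \<open>
  The representing vector is the minimiser of \<open>\<parallel>x\<parallel>\<^sup>2 / 2 - f x\<close>; the parallelogram law
  makes every minimising sequence a Cauchy sequence.
\<close>

lemma Riesz_real:
  fixes f :: "'a::complex_hilbert \<Rightarrow> real"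
  assumes "bounded_linear f"
  obtains z where "\<And>x. f x = Re (cinner x z)"
proof -
  interpret f: bounded_linear f by fact
  obtain c where c: "\<And>x. norm (f x) \<le> norm x * c" using f.bounded by blast
  define J where "J x = (norm x)\<^sup>2 / 2 - f x" for x
  have J_below: "- (c\<^sup>2 / 2) \<le> J x" for x
  proof -
    have "0 \<le> (norm x - c)\<^sup>2" by simp
    then have "norm x * c \<le> (norm x)\<^sup>2 / 2 + c\<^sup>2 / 2"
      by (simp add: power2_diff)
    then show ?thesis using c[of x] by (simp add: J_def)
  qed
  define m where "m = Inf (range J)"
  have bdd: "bdd_below (range J)" using J_below by (meson bdd_belowI2)
  have m_le: "m \<le> J x" for x unfolding m_def by (rule cInf_lower) (use bdd in auto)
  have near: "\<exists>x. J x < m + e" if "e > 0" for e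
    using cInf_lessD[of "range J" "m + e"] that unfolding m_def by auto
  \<comment> \<open>The midpoint has \<open>J\<close>-value at least \<open>m\<close>, and
    \<open>J x + J y\<close> exceeds twice that value by exactly
    \<open>(norm (x - y))\<^sup>2 / 4\<close>.\<close>
  have par: "(norm (x - y))\<^sup>2 \<le> 4 * (J x + J y - 2 * m)" for x y
  proof -
    have mid: "J ((1/2) *\<^sub>R (x + y)) = ((norm x)\<^sup>2 + 2 * Re (cinner x y) + (norm y)\<^sup>2) / 8 - (f x + f y) / 2"
      by (simp add: J_def f.scaleR f.add norm_add_square power_divide
          del: scaleR_add_right)
    show ?thesis
      using m_le[of "(1/2) *\<^sub>R (x + y)"] unfolding mid unfolding J_def norm_diff_square by argo
  qed
  have "\<exists>x. J x < m + inverse (real (Suc n))" for n by (rule near) simp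
  then obtain X where X: "\<And>n. J (X n) < m + inverse (real (Suc n))" by metis
  have "Cauchy X"
  proof (rule metric_CauchyI)
    fix e :: real assume e: "0 < e"
    \<comment> \<open>Two excesses below \<open>e\<^sup>2 / 8\<close>, multiplied by the 4 in
      \<open>par\<close>, stay below \<open>e\<^sup>2\<close>.\<close>
    obtain N where N: "inverse (real (Suc N)) < e\<^sup>2 / 8"
      using reals_Archimedean[of "e\<^sup>2 / 8"] e by auto
    show "\<exists>N. \<forall>k\<ge>N. \<forall>n\<ge>N. dist (X k) (X n) < e"
    proof (intro exI allI impI)
      fix k n assume kn: "N \<le> k" "N \<le> n"
      have "J (X i) < m + e\<^sup>2 / 8" if "N \<le> i" for i
      proof -
        have "inverse (real (Suc i)) \<le> inverse (real (Suc N))"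
          using that by (intro le_imp_inverse_le) auto
        then show ?thesis using X[of i] N by linarith
      qed
      from this[OF kn(1)] this[OF kn(2)] have "(norm (X k - X n))\<^sup>2 < e\<^sup>2"
        using par[of "X k" "X n"] by argo
      then show "dist (X k) (X n) < e"
        using e by (simp add: dist_norm power_less_imp_less_base)
    qed
  qed
  then obtain z where z: "X \<longlonglongrightarrow> z" using Cauchy_convergent_iff convergent_def by blast
  have "(\<lambda>n. J (X n)) \<longlonglongrightarrow> J z"
    unfolding J_def by (intro tendsto_intros f.tendsto z) auto
  moreover have "(\<lambda>n. m + inverse (real (Suc n))) \<longlonglongrightarrow> m + 0"
    by (intro tendsto_intros LIMSEQ_inverse_real_of_nat)
  ultimately have Jz: "J z \<le> m"
    using X by (intro LIMSEQ_le[of "\<lambda>n. J (X n)" "J z" "\<lambda>n. m + inverse (real (Suc n))"])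
      (auto intro: less_imp_le)
  have "f x = Re (cinner x z)" for x
  proof (rule ccontr)
    define d where "d = f x - Re (cinner z x)"
    assume "f x \<noteq> Re (cinner x z)"
    then have d: "d \<noteq> 0" using Re_cinner_commute[of x z] by (simp add: d_def)
    \<comment> \<open>Moving from the minimiser \<open>z\<close> by \<open>t *\<^sub>R x\<close>
      changes \<open>J\<close> by \<open>t\<^sup>2 * (norm x)\<^sup>2 / 2 - t * d\<close>, which
      cannot be negative; for small \<open>t\<close> the linear term would dominate.\<close>
    have quad: "t * d \<le> t\<^sup>2 * (norm x)\<^sup>2 / 2" for t
    proof -
      have "J z \<le> J (z + t *\<^sub>R x)" using Jz m_le order_trans by blast
      then show ?thesis
        by (simp add: J_def norm_add_square cinner_linear f.add f.scaleR d_def power_mult_distrib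
            algebra_simps)
    qed
    \<comment> \<open>The summand 1 keeps the denominator positive even for \<open>x = 0\<close>,
      and makes \<open>t * d\<close> larger than \<open>quad\<close> allows.\<close>
    define t where "t = d / ((norm x)\<^sup>2 + 1)"
    have p: "(norm x)\<^sup>2 + 1 > 0" by (simp add: add_nonneg_pos)
    have "t * d = t\<^sup>2 * ((norm x)\<^sup>2 + 1)"
      using p by (simp add: t_def power2_eq_square)
    moreover have "t\<^sup>2 > 0" using d p by (simp add: t_def)
    moreover have "t\<^sup>2 * (norm x)\<^sup>2 \<ge> 0" by simp
    ultimately show False using quad[of t] unfolding distrib_left by linarith
  qed
  then show ?thesis by (rule that)
qed

lemma cinner_right_ext:
  assumes "\<And>x. cinner x y = cinner x (z::'a::complex_inner)"
  shows "y = z"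
  using assms[of "y - z"] cinner_self_eq_zero_iff[of "y - z"] by (simp add: cinner_diff_right)

lemma bounded_clinearD:
  assumes "bounded_clinear T"
  shows "bounded_linear T" "T (a *\<^sub>C x) = a *\<^sub>C T x"
  using assms by (auto simp: bounded_clinear_def)

lemma bounded_clinear_compose:
  assumes "bounded_clinear S" "bounded_clinear T"
  shows "bounded_clinear (S \<circ> T)"
  using assms bounded_linear_compose[of S T] by (simp add: bounded_clinear_def comp_def)

text \<open>For fixed \<open>y\<close>, real Riesz represents the real part of
  \<open>cinner (T x) y\<close>; inserting \<open>\<i> *\<^sub>C x\<close> settles the imaginary
  part. Boundedness of \<open>S\<close> follows by applying Cauchy-Schwarz to
  \<open>cinner (T (S y)) y\<close>.\<close>

lemma adjoint_ex:
  fixes T :: "'a::complex_hilbert \<Rightarrow> 'a"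
  assumes T: "bounded_clinear T"
  shows "\<exists>S. bounded_clinear S \<and> (\<forall>x y. cinner (T x) y = cinner x (S y))"
proof -
  note T' = bounded_clinearD[OF T]
  have "\<exists>z. \<forall>x. cinner (T x) y = cinner x z" for y
  proof -
    have "bounded_linear (\<lambda>x. Re (cinner (T x) y))"
      using bounded_linear_compose[OF bounded_linear_Re
          bounded_linear_compose[OF bounded_bilinear.bounded_linear_left[OF bounded_bilinear_cinner] T'(1)]] .
    then obtain z where z: "\<And>x. Re (cinner (T x) y) = Re (cinner x z)"
      using Riesz_real by blast
    have "cinner (T x) y = cinner x z" for x
      using z[of x] z[of "\<i> *\<^sub>C x"]
      by (subst (1 2) cinner_eq_Re) (simp add: T')
    then show ?thesis by blast
  qed
  then obtain S where S: "\<And>x y. cinner (T x) y = cinner x (S y)" by metis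
  obtain K where K: "\<And>x. norm (T x) \<le> norm x * K" "K > 0"
    using bounded_linear.pos_bounded[OF T'(1)] by blast
  have add: "S (x + y) = S x + S y" for x y
    by (rule cinner_right_ext) (simp add: S[symmetric] cinner_add_right)
  have scale: "S (a *\<^sub>C y) = a *\<^sub>C S y" for a y
    by (rule cinner_right_ext) (simp add: S[symmetric] cinner_scaleC_right)
  have "norm (S y) \<le> norm y * K" for y
  proof (cases "S y = 0")
    case False
    have "(norm (S y))\<^sup>2 = Re (cinner (T (S y)) y)"
      by (simp add: S Re_cinner_self)
    also have "\<dots> \<le> norm (T (S y)) * norm y" by (rule Re_cinner_le)
    also have "\<dots> \<le> (norm (S y) * K) * norm y" by (intro mult_right_mono K) simp
    finally have "norm (S y) * norm (S y) \<le> norm (S y) * (norm y * K)"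
      by (simp add: power2_eq_square mult_ac)
    then show ?thesis using False by simp
  qed (use K in simp)
  then have "bounded_linear S"
    by (intro bounded_linear_intro[of S K]) (simp_all add: add scale scaleR_scaleC)
  with S scale show ?thesis by (auto simp: bounded_clinear_def)
qed

text \<open>Discharges the definite description: any two candidates have the same inner products
  with every vector.\<close>

lemma cadjoint_unique:
  assumes "bounded_clinear S" "\<And>x y. cinner (T x) y = cinner x (S y)"
  shows "cadjoint T = S"
  unfolding cadjoint_def
proof (rule the_equality)
  show "U = S" if "bounded_clinear U \<and> (\<forall>x y. cinner (T x) y = cinner x (U y))" for U
  proof
    show "U y = S y" for y
      by (rule cinner_right_ext) (use that assms(2) in metis)
  qed
qed (use assms in blast)

lemma
  assumes "bounded_clinear T"
  shows bounded_clinear_cadjoint: "bounded_clinear (cadjoint T)"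
    and cinner_cadjoint: "cinner (T x) y = cinner x (cadjoint T y)"
  using adjoint_ex[OF assms] cadjoint_unique[of _ T] by metis+

section \<open>Positive operators\<close>

lemma positive_opD:
  assumes "positive_op A"
  shows "bounded_clinear A" "bounded_linear A" "0 \<le> Re (cinner (A x) x)"
  using assms by (auto simp: positive_op_def bounded_clinear_def complex_nonneg_Reals_iff)

text \<open>Polarisation: the sesquilinear defect \<open>h\<close> vanishes on the diagonal because
  the form of \<open>A\<close> is real; evaluating it at \<open>x + y\<close> and
  \<open>\<i> *\<^sub>C x + y\<close> makes it vanish everywhere.\<close>

lemma positive_op_symmetric:
  assumes A: "positive_op A"
  shows "cinner (A x) y = cinner x (A y)"
proof -
  interpret bounded_linear A using positive_opD(2)[OF A] .
  note sc = bounded_clinearD(2)[OF positive_opD(1)[OF A]]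
  define h where "h x y = cinner (A x) y - cinner x (A y)" for x y
  have self: "h u u = 0" for u
  proof -
    have "Im (cinner (A u) u) = 0"
      using A by (auto simp: positive_op_def complex_nonneg_Reals_iff)
    then show ?thesis
      using cinner_commute[of u "A u"] by (simp add: h_def complex_eq_iff)
  qed
  have "h x y + h y x = 0"
    using self[of "x + y"] self[of x] self[of y] by (simp add: h_def add cinner_linear algebra_simps)
  moreover have "\<i> * h x y - \<i> * h y x = 0"
    using self[of "\<i> *\<^sub>C x + y"] self[of x] self[of y]
    by (simp add: h_def add sc cinner_linear cinner_scaleC_left cinner_scaleC_right algebra_simps)
  ultimately have "h x y = 0" by (auto simp: complex_eq_iff)
  then show ?thesis by (simp add: h_def)
qed

lemma cadjoint_positive_op: "positive_op A \<Longrightarrow> cadjoint A = A"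
  by (rule cadjoint_unique) (use positive_opD positive_op_symmetric in blast)+

lemma positive_op_cadjoint_compose:
  assumes "bounded_clinear T"
  shows "positive_op (cadjoint T \<circ> T)"
proof -
  have "cinner (cadjoint T (T x)) x = cinner (T x) (T x)" for x
    by (subst cinner_commute)
      (simp add: cinner_cadjoint[OF assms, symmetric] cinner_self)
  then show ?thesis
    using assms cinner_self_nonneg
    by (auto simp: positive_op_def bounded_clinear_compose bounded_clinear_cadjoint)
qed

lemma positive_op_square:
  assumes "positive_op A"
  shows "positive_op (A \<circ> A)"
  using positive_op_cadjoint_compose[of A] cadjoint_positive_op[OF assms] positive_opD(1)[OF assms]
  by simp

text \<open>Evaluate the nonnegative form of \<open>R\<close> at \<open>x - (1 / K) R x\<close>.\<close>

lemma norm_square_le_nonneg_form: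
  fixes R :: "'a::complex_inner \<Rightarrow> 'a"
  assumes R: "linear R" and M: "csubspace M" and inv: "R ` M \<subseteq> M"
    and sym: "\<And>x y. x \<in> M \<Longrightarrow> y \<in> M \<Longrightarrow> Re (cinner (R x) y) = Re (cinner x (R y))"
    and nonneg: "\<And>x. x \<in> M \<Longrightarrow> 0 \<le> Re (cinner (R x) x)"
    and bound: "\<And>x. x \<in> M \<Longrightarrow> norm (R x) \<le> K * norm x"
    and K: "0 < K" and x: "x \<in> M"
  shows "(norm (R x))\<^sup>2 \<le> K * Re (cinner (R x) x)"
proof -
  interpret linear R by fact
  have Rx: "R x \<in> M" using inv x by auto
  \<comment> \<open>This value minimises \<open>K * t\<^sup>2 - 2 * t\<close>, the coefficient of
    \<open>(norm (R x))\<^sup>2\<close> in the final estimate; the minimum is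
    \<open>- 1 / K\<close>.\<close>
  define t where "t = 1 / K"
  have "x - t *\<^sub>R R x \<in> M"
    using M x Rx by (simp add: complex_vector.subspace_diff csubspace_scaleR)
  then have "0 \<le> Re (cinner (R (x - t *\<^sub>R R x)) (x - t *\<^sub>R R x))" by (rule nonneg)
  also have "\<dots> = Re (cinner (R x) x) - 2 * t * (norm (R x))\<^sup>2 + t\<^sup>2 * Re (cinner (R (R x)) (R x))"
    using sym[OF Rx x]
    by (simp add: diff scale cinner_linear Re_cinner_self power2_eq_square algebra_simps)
  also have "\<dots> \<le> Re (cinner (R x) x) - 2 * t * (norm (R x))\<^sup>2 + t\<^sup>2 * (K * (norm (R x))\<^sup>2)"
  proof -
    have "Re (cinner (R (R x)) (R x)) \<le> norm (R (R x)) * norm (R x)" by (rule Re_cinner_le)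
    also have "\<dots> \<le> K * norm (R x) * norm (R x)"
      using bound[OF Rx] by (intro mult_right_mono) auto
    finally show ?thesis
      by (intro add_left_mono mult_left_mono) (simp_all add: power2_eq_square mult_ac)
  qed
  finally show ?thesis using K by (simp add: t_def field_simps power2_eq_square)
qed

lemma positive_op_norm_square_le:
  assumes A: "positive_op A" and K: "0 < K" "\<And>x. norm (A x) \<le> K * norm x"
  shows "(norm (A x))\<^sup>2 \<le> K * Re (cinner (A x) x)"
  by (rule norm_square_le_nonneg_form[of A UNIV])
    (use positive_opD[OF A] positive_op_symmetric[OF A] K in
      \<open>auto simp: bounded_linear.linear complex_vector.subspace_UNIV\<close>)

lemma positive_op_form_eq_0:
  assumes A: "positive_op A" and "Re (cinner (A x) x) = 0"
  shows "A x = 0"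
proof -
  obtain K where "0 < K" "\<And>x. norm (A x) \<le> K * norm x"
    using bounded_linear.pos_bounded[OF positive_opD(2)[OF A]] by (metis mult.commute)
  then show ?thesis using positive_op_norm_square_le[OF A, of K x] assms(2) by simp
qed

section \<open>Square roots\<close>

text \<open>
  The solution of \<open>S = (B + S\<^sup>2) / 2\<close> is the limit of the obvious iteration from \<open>0\<close>, whose
  increments are bounded in norm by those of the scalar iteration for \<open>B = 1\<close>, which
  increases and is bounded by \<open>1\<close>.
\<close>

lemma contraction_quadratic_solution:
  fixes B :: "'a::banach \<Rightarrow>\<^sub>L 'a"
  assumes B: "norm B \<le> 1"
  obtains S where "norm S \<le> 1" "B + (S o\<^sub>L S) = 2 *\<^sub>R S"
    "\<And>V. \<lbrakk>closed V; subspace V; B \<in> V; \<And>X. X \<in> V \<Longrightarrow> (X o\<^sub>L X) \<in> V\<rbrakk> \<Longrightarrow> S \<in> V"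
proof -
  define F where "F X = (1/2) *\<^sub>R (B + (X o\<^sub>L X))" for X
  define X where "X n = (F ^^ n) 0" for n
  define s :: "nat \<Rightarrow> real" where "s n = ((\<lambda>t. (1 + t\<^sup>2) / 2) ^^ n) 0" for n
  have X0: "X 0 = 0" and XS: "X (Suc n) = F (X n)" for n by (simp_all add: X_def)
  have s0: "s 0 = 0" and sS: "s (Suc n) = (1 + (s n)\<^sup>2) / 2" for n by (simp_all add: s_def)
  have s_bd: "0 \<le> s n \<and> s n \<le> 1" for n
    by (induction n) (auto simp: s0 sS intro: power_le_one)
  have s_mono: "s n \<le> s (Suc n)" for n
    using zero_le_power2[of "s n - 1"] by (simp add: sS power2_diff)
  have nX: "norm (X n) \<le> s n" for n
  proof (induction n)
    case (Suc n)
    have "norm (X n o\<^sub>L X n) \<le> norm (X n) * norm (X n)" by (rule norm_blinfun_compose)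
    also have "\<dots> \<le> s n * s n" using Suc s_bd by (intro mult_mono) auto
    finally have "norm (B + (X n o\<^sub>L X n)) \<le> 1 + (s n)\<^sup>2"
      using B norm_triangle_ineq[of B "X n o\<^sub>L X n"] by (simp add: power2_eq_square)
    then show ?case by (simp add: XS sS F_def)
  qed (simp add: X0 s0)
  have incr: "norm (X (Suc n) - X n) \<le> s (Suc n) - s n" for n
  proof (induction n)
    case 0
    then show ?case using nX[of "Suc 0"] by (simp add: X0 s0)
  next
    case (Suc n)
    let ?D = "X (Suc n) - X n"
    \<comment> \<open>Difference of squares without commutativity: the mixed product of
      \<open>Y\<close> and \<open>Z\<close> is subtracted and added.\<close>
    have "F Y - F Z = (1/2) *\<^sub>R ((Y o\<^sub>L (Y - Z)) + ((Y - Z) o\<^sub>L Z))" for Y Z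
      by (simp add: F_def bounded_bilinear.diff_left[OF bounded_bilinear_blinfun_compose]
          bounded_bilinear.diff_right[OF bounded_bilinear_blinfun_compose] algebra_simps)
    then have "X (Suc (Suc n)) - X (Suc n) = (1/2) *\<^sub>R ((X (Suc n) o\<^sub>L ?D) + (?D o\<^sub>L X n))"
      by (simp only: XS)
    also have "norm \<dots> \<le> (norm (X (Suc n)) * norm ?D + norm ?D * norm (X n)) / 2"
      using norm_triangle_ineq[of "X (Suc n) o\<^sub>L ?D" "?D o\<^sub>L X n"]
        norm_blinfun_compose[of "X (Suc n)" ?D] norm_blinfun_compose[of ?D "X n"] by simp
    also have "\<dots> \<le> (s (Suc n) * (s (Suc n) - s n) + (s (Suc n) - s n) * s n) / 2"
      using nX Suc s_bd s_mono by (intro divide_right_mono add_mono mult_mono) auto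
    \<comment> \<open>The numerator is \<open>(s (Suc n))\<^sup>2 - (s n)\<^sup>2\<close>, so the
      recursion for \<open>s\<close> reproduces the next scalar increment.\<close>
    also have "\<dots> = s (Suc (Suc n)) - s (Suc n)"
      unfolding sS[of "Suc n"] by (subst (5) sS) (simp add: power2_eq_square field_simps)
    finally show ?case .
  qed
  have "summable (\<lambda>n. s (Suc n) - s n)"
  proof (rule telescope_summable)
    have "convergent s"
      by (rule Bseq_monoseq_convergent)
        (use s_bd s_mono in \<open>auto intro!: BseqI'[of _ 1] simp: monoseq_Suc\<close>)
    then show "s \<longlonglongrightarrow> lim s" by (simp add: convergent_LIMSEQ_iff)
  qed
  then have "summable (\<lambda>n. X (Suc n) - X n)"
    by (rule summable_comparison_test'[where N = 0]) (use incr in auto)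
  then have "convergent (\<lambda>n. \<Sum>k<n. X (Suc k) - X k)" by (simp add: summable_iff_convergent)
  then have "convergent X" by (simp add: sum_lessThan_telescope X0)
  then obtain S where S: "X \<longlonglongrightarrow> S" by (auto simp: convergent_def)
  have "norm S \<le> 1"
    by (rule LIMSEQ_le_const2[OF tendsto_norm[OF S]]) (use nX s_bd order_trans in blast)
  moreover have "F S = S"
  proof (rule LIMSEQ_unique)
    show "(\<lambda>n. X (Suc n)) \<longlonglongrightarrow> F S"
      unfolding XS F_def by (intro tendsto_intros bounded_bilinear.tendsto[OF bounded_bilinear_blinfun_compose] S)
    show "(\<lambda>n. X (Suc n)) \<longlonglongrightarrow> S" using S by (rule LIMSEQ_Suc)
  qed
  then have "2 *\<^sub>R F S = 2 *\<^sub>R S" by simp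
  then have "B + (S o\<^sub>L S) = 2 *\<^sub>R S" by (simp add: F_def)
  \<comment> \<open>An induction principle for the limit. It is used with \<open>V\<close>
    consisting of the operators that commute with a given one, are symmetric, or preserve a closed
    subspace.\<close>
  moreover have "S \<in> V"
    if "closed V" "subspace V" "B \<in> V" "\<And>X. X \<in> V \<Longrightarrow> (X o\<^sub>L X) \<in> V" for V
  proof -
    have "X n \<in> V" for n
      by (induction n) (use that in \<open>auto simp: X0 XS F_def subspace_0 subspace_add subspace_scale\<close>)
    then show ?thesis using closed_sequentially[OF that(1) _ S] by blast
  qed
  ultimately show ?thesis by (rule that)
qed

text \<open>With the contraction \<open>B = I - A / K\<close>, the equation
  \<open>B + S\<^sup>2 = 2 S\<close> says \<open>(I - S)\<^sup>2 = A / K\<close>, so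
  \<open>sqrt K\<close> times \<open>I - S\<close> is a root. The last two conclusions retain what
  is needed of its being a limit of polynomials in \<open>A\<close>.\<close>

lemma positive_sqrt_ex:
  fixes A :: "'a::complex_hilbert \<Rightarrow> 'a"
  assumes A: "positive_op A"
  obtains Q where "positive_op Q" "Q \<circ> Q = A"
    "\<And>M. \<lbrakk>csubspace M; closed M; A ` M \<subseteq> M\<rbrakk> \<Longrightarrow> Q ` M \<subseteq> M"
    "\<And>C. \<lbrakk>bounded_linear C; C \<circ> A = A \<circ> C\<rbrakk> \<Longrightarrow> C \<circ> Q = Q \<circ> C"
proof -
  interpret A: bounded_linear A using positive_opD(2)[OF A] .
  note A_scaleC = bounded_clinearD(2)[OF positive_opD(1)[OF A]]
  obtain K where K: "0 < K" "\<And>x. norm (A x) \<le> K * norm x"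
    using A.pos_bounded by (metis mult.commute)
  define B where "B = Blinfun (\<lambda>x. x - (1/K) *\<^sub>R A x)"
  have B: "blinfun_apply B x = x - (1/K) *\<^sub>R A x" for x
    unfolding B_def
    by (subst bounded_linear_Blinfun_apply)
      (auto intro!: bounded_linear_sub bounded_linear_ident bounded_linear_const_scaleR A.bounded_linear_axioms)
  have "norm B \<le> 1"
  \<comment> \<open>In the expansion of \<open>(norm (B x))\<^sup>2\<close>, the cross term
    \<open>- 2 * Re (cinner (A x) x) / K\<close> absorbs the quadratic term, which is at most half
    its size.\<close>
  proof (rule norm_blinfun_bound)
    fix x
    have "(norm (A x))\<^sup>2 \<le> K * Re (cinner (A x) x)"
      by (rule positive_op_norm_square_le[OF A K])
    then have "(norm (A x))\<^sup>2 / K\<^sup>2 \<le> Re (cinner (A x) x) / K"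
      using K(1) by (simp add: field_simps power2_eq_square)
    moreover have "0 \<le> Re (cinner (A x) x) / K"
      using positive_opD(3)[OF A, of x] K(1) by simp
    ultimately have "(norm (blinfun_apply B x))\<^sup>2 \<le> (norm x)\<^sup>2"
      using Re_cinner_commute[of x "A x"] K(1)
      by (simp add: B norm_diff_square cinner_linear power_divide)
    then show "norm (blinfun_apply B x) \<le> 1 * norm x"
      using power2_le_imp_le[of "norm (blinfun_apply B x)" "norm x"] by simp
  qed simp
  then obtain S where S: "norm S \<le> 1" "B + (S o\<^sub>L S) = 2 *\<^sub>R S"
    and S_in: "\<And>V. \<lbrakk>closed V; subspace V; B \<in> V; \<And>X. X \<in> V \<Longrightarrow> (X o\<^sub>L X) \<in> V\<rbrakk> \<Longrightarrow> S \<in> V"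
    using contraction_quadratic_solution by blast
  define Q where "Q x = sqrt K *\<^sub>R (x - blinfun_apply S x)" for x
  have QQ: "Q (Q x) = A x" for x
  proof -
    have "blinfun_apply B x + blinfun_apply S (blinfun_apply S x) = 2 *\<^sub>R blinfun_apply S x"
      using arg_cong[OF S(2), of "\<lambda>X. blinfun_apply X x"]
      by (simp add: blinfun.add_left blinfun.scaleR_left)
    then have "x - 2 *\<^sub>R blinfun_apply S x + blinfun_apply S (blinfun_apply S x) = (1/K) *\<^sub>R A x"
      by (simp add: B algebra_simps)
    moreover have "Q (Q x) = K *\<^sub>R (x - 2 *\<^sub>R blinfun_apply S x + blinfun_apply S (blinfun_apply S x))"
      using K(1) by (simp add: Q_def blinfun.diff_right blinfun.scaleR_right scaleR_2 algebra_simps)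
    ultimately show ?thesis using K(1) by simp
  qed
  have comm: "C \<circ> Q = Q \<circ> C" if C: "bounded_linear C" and CA: "C \<circ> A = A \<circ> C" for C
  proof -
    interpret C: bounded_linear C by fact
    have "S \<in> {X. \<forall>x. C (blinfun_apply X x) = blinfun_apply X (C x)}"
    proof (rule S_in)
      show "closed {X. \<forall>x. C (blinfun_apply X x) = blinfun_apply X (C x)}"
        by (intro closed_Collect_all closed_Collect_eq C.continuous_on continuous_intros)
      show "B \<in> {X. \<forall>x. C (blinfun_apply X x) = blinfun_apply X (C x)}"
        using CA by (simp add: B C.diff C.scaleR fun_eq_iff)
    qed (auto simp: subspace_def blinfun.add_left blinfun.scaleR_left C.add C.scaleR)
    then show ?thesis by (auto simp: Q_def C.diff C.scaleR)
  qed
  \<comment> \<open>The limit \<open>S\<close> is only known to be real-linear; complex homogeneity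
    comes from commutation with multiplication by \<open>a\<close>.\<close>
  have Q_scaleC: "Q (a *\<^sub>C x) = a *\<^sub>C Q x" for a x
    using comm[OF bounded_linear_scaleC[of a]] by (simp add: A_scaleC fun_eq_iff)
  have S_sym: "cinner (blinfun_apply S x) y = cinner x (blinfun_apply S y)" for x y
  proof -
    have "S \<in> {X. \<forall>x y. cinner (blinfun_apply X x) y = cinner x (blinfun_apply X y)}"
    proof (rule S_in)
      show "closed {X. \<forall>x y. cinner (blinfun_apply X x) y = cinner x (blinfun_apply X y)}"
        by (intro closed_Collect_all closed_Collect_eq continuous_intros)
      show "B \<in> {X. \<forall>x y. cinner (blinfun_apply X x) y = cinner x (blinfun_apply X y)}"
        by (simp add: B cinner_linear positive_op_symmetric[OF A])
    qed (auto simp: subspace_def blinfun.add_left blinfun.scaleR_left cinner_linear)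
    then show ?thesis by blast
  qed
  have "bounded_linear Q"
    unfolding Q_def
    by (intro bounded_linear_const_scaleR bounded_linear_sub bounded_linear_ident
        blinfun.bounded_linear_right)
  \<comment> \<open>Symmetry of \<open>S\<close> makes the form real, and
    \<open>norm S \<le> 1\<close> makes that of \<open>I - S\<close> nonnegative.\<close>
  moreover have "cinner (Q x) x \<in> \<real>\<^sub>\<ge>\<^sub>0" for x
  proof -
    have "Im (cinner (blinfun_apply S x) x) = 0"
      using S_sym[of x x] cinner_commute[of x "blinfun_apply S x"] by (simp add: complex_eq_iff)
    moreover have "Re (cinner (blinfun_apply S x) x) \<le> (norm x)\<^sup>2"
    proof -
      have "Re (cinner (blinfun_apply S x) x) \<le> norm (blinfun_apply S x) * norm x"
        by (rule Re_cinner_le)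
      also have "\<dots> \<le> (1 * norm x) * norm x"
        by (intro mult_right_mono order_trans[OF norm_blinfun] S) auto
      finally show ?thesis by (simp add: power2_eq_square)
    qed
    ultimately show ?thesis
      using K(1) by (simp add: Q_def complex_nonneg_Reals_iff cinner_linear cinner_self)
  qed
  ultimately have "positive_op Q" by (simp add: Q_scaleC positive_op_def bounded_clinear_def)
  moreover have "Q \<circ> Q = A" using QQ by auto
  moreover have "Q ` M \<subseteq> M" if M: "csubspace M" "closed M" "A ` M \<subseteq> M" for M
  proof -
    have "S \<in> {X. \<forall>x\<in>M. blinfun_apply X x \<in> M}"
    proof (rule S_in)
      have "closed ((\<lambda>X. blinfun_apply X x) -` M)" for x :: 'a
        by (intro closed_vimage M continuous_intros)
      then have "closed (\<Inter>x\<in>M. (\<lambda>X. blinfun_apply X x) -` M)" by blast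
      then show "closed {X. \<forall>x\<in>M. blinfun_apply X x \<in> M}" by (simp add: vimage_def INTER_eq)
      show "B \<in> {X. \<forall>x\<in>M. blinfun_apply X x \<in> M}"
        using M by (auto simp: B complex_vector.subspace_diff csubspace_scaleR image_subset_iff)
    qed (use M in \<open>auto simp: subspace_def blinfun.add_left blinfun.scaleR_left
          complex_vector.subspace_0 complex_vector.subspace_add csubspace_scaleR\<close>)
    then show ?thesis
      using M(1) by (auto simp: Q_def complex_vector.subspace_diff csubspace_scaleR)
  qed
  ultimately show ?thesis by (rule that) (assumption | rule comm)+
qed

text \<open>
  If \<open>y = (P - Q) x\<close> then \<open>(P + Q) y = 0\<close>, so both nonnegative forms vanish at \<open>y\<close>.
\<close>

lemma commuting_positive_sqrt_unique:
  assumes P: "positive_op P" and Q: "positive_op Q" and eq: "P \<circ> P = Q \<circ> Q"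
    and comm: "P \<circ> Q = Q \<circ> P"
  shows "P = Q"
proof
  fix x
  interpret P: bounded_linear P using positive_opD(2)[OF P] .
  interpret Q: bounded_linear Q using positive_opD(2)[OF Q] .
  define y where "y = P x - Q x"
  have "P (P x) = Q (Q x)" "P (Q x) = Q (P x)" using eq comm by (metis comp_apply)+
  then have "P y + Q y = 0" by (simp add: y_def P.diff Q.diff)
  then have "cinner (P y) y + cinner (Q y) y = 0"
    by (simp add: cinner_add_left[symmetric])
  then have "Re (cinner (P y) y) + Re (cinner (Q y) y) = 0" by (simp add: complex_eq_iff)
  then have "Re (cinner (P y) y) = 0" "Re (cinner (Q y) y) = 0"
    using positive_opD(3)[OF P, of y] positive_opD(3)[OF Q, of y] by linarith+
  then have "P y = 0" "Q y = 0" using P Q positive_op_form_eq_0 by blast+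
  moreover have "cinner y y = cinner x (P y - Q y)"
    by (subst (1) y_def)
      (simp add: cinner_linear positive_op_symmetric[OF P] positive_op_symmetric[OF Q])
  ultimately have "cinner y y = 0" by simp
  then show "P x = Q x" by (simp add: cinner_self_eq_zero_iff y_def)
qed

text \<open>Both roots are compared with the constructed root \<open>R\<close>: it commutes with
  whatever commutes with \<open>P \<circ> P\<close>, hence with \<open>P\<close> and with
  \<open>Q\<close>.\<close>

lemma positive_sqrt_unique:
  assumes P: "positive_op P" and Q: "positive_op Q" and eq: "P \<circ> P = Q \<circ> Q"
  shows "P = Q"
proof -
  obtain R where R: "positive_op R" "R \<circ> R = P \<circ> P"
    and comm: "\<And>C. \<lbrakk>bounded_linear C; C \<circ> (P \<circ> P) = (P \<circ> P) \<circ> C\<rbrakk> \<Longrightarrow> C \<circ> R = R \<circ> C"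
    using positive_sqrt_ex[OF positive_op_square[OF P]] by metis
  have "P = R"
    by (rule commuting_positive_sqrt_unique)
      (use P R positive_opD(2) comm[of P] in \<open>auto simp: comp_assoc\<close>)
  moreover have "Q = R"
    by (rule commuting_positive_sqrt_unique)
      (use Q R positive_opD(2) eq comm[of Q] in \<open>auto simp: comp_assoc\<close>)
  ultimately show ?thesis by simp
qed

lemma
  assumes "positive_op A"
  shows positive_op_sqrt: "positive_op (op_sqrt A)"
    and op_sqrt_compose: "op_sqrt A \<circ> op_sqrt A = A"
proof -
  obtain Q where Q: "positive_op Q \<and> Q \<circ> Q = A"
    using positive_sqrt_ex[OF assms] by metis
  have "positive_op (op_sqrt A) \<and> op_sqrt A \<circ> op_sqrt A = A"
    unfolding op_sqrt_def by (rule theI[of _ Q]) (use positive_sqrt_unique Q in metis)+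
  then show "positive_op (op_sqrt A)" "op_sqrt A \<circ> op_sqrt A = A" by blast+
qed

section \<open>Subspaces reducing a positive operator and its square\<close>

lemma positive_op_square_invariant_iff:
  assumes P: "positive_op P" and M: "csubspace M" "closed M"
  shows "(P \<circ> P) ` M \<subseteq> M \<longleftrightarrow> P ` M \<subseteq> M"
proof
  obtain Q where Q: "positive_op Q" "Q \<circ> Q = P \<circ> P"
    "\<And>M. \<lbrakk>csubspace M; closed M; (P \<circ> P) ` M \<subseteq> M\<rbrakk> \<Longrightarrow> Q ` M \<subseteq> M"
    using positive_sqrt_ex[OF positive_op_square[OF P]] by metis
  then have "Q = P" using P positive_sqrt_unique by metis
  then show "(P \<circ> P) ` M \<subseteq> M \<Longrightarrow> P ` M \<subseteq> M" using Q(3) M by metis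
qed auto

lemma reduces_positive_op_iff:
  "positive_op P \<Longrightarrow> reduces M P \<longleftrightarrow> csubspace M \<and> closed M \<and> P ` M \<subseteq> M"
  by (auto simp: reduces_def cadjoint_positive_op)

lemma reduces_square_iff: "positive_op P \<Longrightarrow> reduces M (P \<circ> P) \<longleftrightarrow> reduces M P"
  using positive_op_square_invariant_iff[of P M] reduces_positive_op_iff[of P M]
    reduces_positive_op_iff[of "P \<circ> P" M] positive_op_square[of P]
  by blast

section \<open>The minimum modulus of a square\<close>

lemma min_modulus_on_le:
  assumes "x \<in> M" "norm x = 1"
  shows "min_modulus_on M A \<le> norm (A x)"
  unfolding min_modulus_on_def
  by (rule cInf_lower) (use assms in \<open>auto intro!: bdd_belowI[of _ 0]\<close>)

lemma csubspace_unit_vector: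
  assumes "csubspace M" "M \<noteq> {0}"
  obtains x where "x \<in> M" "norm (x::'a::complex_inner) = 1"
proof -
  obtain y where "y \<in> M" "y \<noteq> 0" using assms complex_vector.subspace_0 by blast
  then show ?thesis
    using that[of "(1 / norm y) *\<^sub>R y"] assms(1) by (simp add: csubspace_scaleR)
qed

text \<open>A nonzero subspace contains a unit vector, so the infimum is over a nonempty
  set.\<close>

lemma min_modulus_on_greatest:
  assumes "csubspace M" "M \<noteq> {0}" "\<And>x. x \<in> M \<Longrightarrow> norm x = 1 \<Longrightarrow> c \<le> norm (A x)"
  shows "c \<le> min_modulus_on M A"
  unfolding min_modulus_on_def
  by (rule cInf_greatest) (use assms csubspace_unit_vector[OF assms(1,2)] in auto)

lemma min_modulus_on_less:
  assumes "csubspace M" "M \<noteq> {0}" "min_modulus_on M A < c"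
  obtains x where "x \<in> M" "norm x = 1" "norm (A x) < c"
  using min_modulus_on_greatest[OF assms(1,2), of c A] assms(3) by (meson not_le)

lemma min_modulus_on_mult_norm_le:
  assumes "linear A" "csubspace M" "x \<in> M"
  shows "min_modulus_on M A * norm x \<le> norm (A x)"
proof (cases "x = 0")
  case False
  then have "min_modulus_on M A \<le> norm (A ((1 / norm x) *\<^sub>R x))"
    using assms by (intro min_modulus_on_le) (auto simp: csubspace_scaleR)
  then show ?thesis using False by (simp add: linear_scale[OF assms(1)] field_simps)
qed simp

lemma
  assumes P: "positive_op P" and M: "csubspace M" "M \<noteq> {0}" and inv: "P ` M \<subseteq> M"
  shows min_modulus_on_square: "min_modulus_on M (P \<circ> P) = (min_modulus_on M P)\<^sup>2"
    and minimum_attaining_on_square: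
      "minimum_attaining_on M (P \<circ> P) \<longleftrightarrow> minimum_attaining_on M P"
proof -
  interpret P: bounded_linear P using positive_opD(2)[OF P] .
  define m where "m = min_modulus_on M P"
  have m0: "0 \<le> m" unfolding m_def by (rule min_modulus_on_greatest[OF M]) simp
  have m: "m * norm x \<le> norm (P x)" if "x \<in> M" for x
    unfolding m_def using min_modulus_on_mult_norm_le[OF P.linear_axioms M(1) that] .
  have m2: "m * norm (P x) \<le> norm (P (P x))" if "x \<in> M" for x
    using m[of "P x"] that inv by auto
  have lower: "m\<^sup>2 \<le> norm (P (P x))" if "x \<in> M" "norm x = 1" for x
    using mult_left_mono[OF m[OF that(1)] m0] m2[OF that(1)] that(2)
    by (simp add: power2_eq_square)
  define R where "R x = P (P x) - m\<^sup>2 *\<^sub>R x" for x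
  have R_form: "Re (cinner (R x) x) = (norm (P x))\<^sup>2 - m\<^sup>2 * (norm x)\<^sup>2" for x
    by (simp add: R_def cinner_linear positive_op_symmetric[OF P, of "P x"] Re_cinner_self)
  have R_lin: "bounded_linear R"
    unfolding R_def
    by (intro bounded_linear_sub bounded_linear_const_scaleR bounded_linear_ident
        bounded_linear_compose[of P P] P.bounded_linear_axioms)
  then obtain K where K: "0 < K" "\<And>x. norm (R x) \<le> K * norm x"
    using bounded_linear.pos_bounded by (metis mult.commute)
  \<comment> \<open>On \<open>M\<close> the form of \<open>R\<close> is nonnegative by the choice of
    \<open>m\<close>. Hence \<open>R x\<close> is small whenever \<open>norm (P x)\<close> is close
    to \<open>m\<close>: a near minimiser of \<open>P\<close> is an approximate eigenvector of
    \<open>P \<circ> P\<close> for \<open>m\<^sup>2\<close>.\<close>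
  have R_le: "(norm (R x))\<^sup>2 \<le> K * ((norm (P x))\<^sup>2 - m\<^sup>2)" if x: "x \<in> M" "norm x = 1" for x
  proof -
    have "(norm (R x))\<^sup>2 \<le> K * Re (cinner (R x) x)"
    proof (rule norm_square_le_nonneg_form[OF _ M(1) _ _ _ _ K(1) x(1)])
      show "R ` M \<subseteq> M"
        using M inv by (auto simp: R_def complex_vector.subspace_diff csubspace_scaleR image_subset_iff)
      show "Re (cinner (R x) y) = Re (cinner x (R y))" for x y
        by (simp add: R_def cinner_linear positive_op_symmetric[OF P])
      show "0 \<le> Re (cinner (R x) x)" if "x \<in> M" for x
        using power_mono[OF m[OF that], of 2] m0 by (simp add: R_form power_mult_distrib)
    qed (use R_lin K in \<open>auto simp: bounded_linear.linear\<close>)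
    then show ?thesis using x by (simp add: R_form)
  qed
  have PP_le: "norm (P (P x)) \<le> m\<^sup>2 + norm (R x)" if "norm x = 1" for x
    using norm_triangle_ineq[of "m\<^sup>2 *\<^sub>R x" "R x"] that by (simp add: R_def)
  show mod: "min_modulus_on M (P \<circ> P) = m\<^sup>2"
  proof (rule antisym)
    show "min_modulus_on M (P \<circ> P) \<le> m\<^sup>2"
    proof (rule field_le_epsilon)
      fix e :: real assume e: "0 < e"
      \<comment> \<open>The threshold is chosen so that \<open>R_le\<close> yields exactly
        \<open>norm (R x) \<le> e\<close>.\<close>
      have "m < sqrt (m\<^sup>2 + e\<^sup>2 / K)"
        using m0 e K(1) by (intro real_less_rsqrt) simp
      then obtain x where x: "x \<in> M" "norm x = 1" "norm (P x) < sqrt (m\<^sup>2 + e\<^sup>2 / K)"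
        using min_modulus_on_less[OF M] unfolding m_def by blast
      have "(norm (P x))\<^sup>2 < (sqrt (m\<^sup>2 + e\<^sup>2 / K))\<^sup>2"
        using x(3) by (intro power_strict_mono) auto
      then have "(norm (P x))\<^sup>2 - m\<^sup>2 \<le> e\<^sup>2 / K" using K(1) by simp
      then have "K * ((norm (P x))\<^sup>2 - m\<^sup>2) \<le> e\<^sup>2" using K(1) by (simp add: field_simps)
      with R_le[OF x(1,2)] have "(norm (R x))\<^sup>2 \<le> e\<^sup>2" by (rule order_trans)
      then have "norm (R x) \<le> e" by (rule power2_le_imp_le) (use e in simp)
      then show "min_modulus_on M (P \<circ> P) \<le> m\<^sup>2 + e"
        using PP_le[OF x(2)] min_modulus_on_le[OF x(1,2), of "P \<circ> P"] by simp
    qed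
    show "m\<^sup>2 \<le> min_modulus_on M (P \<circ> P)"
      by (rule min_modulus_on_greatest[OF M]) (simp add: lower)
  qed
  show "minimum_attaining_on M (P \<circ> P) \<longleftrightarrow> minimum_attaining_on M P"
  proof
    assume "minimum_attaining_on M P"
    then obtain x where x: "x \<in> M" "norm x = 1" "norm (P x) = m"
      by (auto simp: minimum_attaining_on_def m_def)
    then have "R x = 0" using R_le[OF x(1,2)] by simp
    then have "norm (P (P x)) = m\<^sup>2"
      using PP_le[OF x(2)] lower[OF x(1,2)] by simp
    then show "minimum_attaining_on M (P \<circ> P)"
      using x by (auto simp: minimum_attaining_on_def mod)
  next
    assume "minimum_attaining_on M (P \<circ> P)"
    then obtain x where x: "x \<in> M" "norm x = 1" "norm (P (P x)) = m\<^sup>2"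
      by (auto simp: minimum_attaining_on_def mod)
    \<comment> \<open>For positive \<open>m\<close>, cancel it in
      \<open>m * norm (P x) \<le> m\<^sup>2\<close>. For \<open>m = 0\<close>,
      \<open>P (P x) = 0\<close> and symmetry forces \<open>P x = 0\<close>.\<close>
    have "norm (P x) = m"
    proof (cases "m = 0")
      case True
      then have "Re (cinner (P x) (P x)) = 0"
        using x(3) by (simp add: positive_op_symmetric[OF P])
      then show ?thesis using True by (simp add: Re_cinner_self)
    next
      case False
      then have "norm (P x) \<le> m"
        using m2[OF x(1)] x(3) m0 by (simp add: power2_eq_square)
      then show ?thesis using m[OF x(1)] x(2) by simp
    qed
    then show "minimum_attaining_on M P"
      using x by (auto simp: minimum_attaining_on_def m_def)
  qed
qed

section \<open>Membership in \<open>\<M>\<^sub>r\<close>\<close>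

lemma positive_op_square_min_attaining_reducing_iff:
  assumes P: "positive_op P"
  shows "P \<in> \<M>\<^sub>r \<longleftrightarrow> P \<circ> P \<in> \<M>\<^sub>r"
proof -
  have "minimum_attaining_on M (P \<circ> P) \<longleftrightarrow> minimum_attaining_on M P"
    if "reduces M P" "M \<noteq> {0}" for M
    using minimum_attaining_on_square[OF P] that by (auto simp: reduces_def)
  then show ?thesis
    using positive_opD(1)[OF P] positive_opD(1)[OF positive_op_square[OF P]] reduces_square_iff[OF P]
    by (auto simp: min_attaining_reducing_def)
qed

theorem proposition3p9:
  fixes T :: "'a::complex_hilbert \<Rightarrow> 'a"
  assumes "infinite_dimensional TYPE('a)"
    and "separable_space (euclidean :: 'a topology)"
    and "bounded_clinear T"
  shows "(op_abs T \<in> \<M>\<^sub>r \<longleftrightarrow> cadjoint T \<circ> T \<in> \<M>\<^sub>r)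
    \<and> (op_abs T \<in> \<M>\<^sub>r \<longrightarrow> T \<in> \<M>\<^sub>r)
    \<and> (positive_op T \<longrightarrow> (T \<in> \<M>\<^sub>r \<longleftrightarrow> T \<circ> T \<in> \<M>\<^sub>r))"
proof -
  note TT = positive_op_cadjoint_compose[OF assms(3)]
  have P: "positive_op (op_abs T)" and PP: "op_abs T \<circ> op_abs T = cadjoint T \<circ> T"
    unfolding op_abs_def using positive_op_sqrt[OF TT] op_sqrt_compose[OF TT] by blast+
  have norm_eq: "norm (op_abs T x) = norm (T x)" for x
  proof -
    have "cinner (op_abs T x) (op_abs T x) = cinner x (cadjoint T (T x))"
      using PP by (metis comp_apply positive_op_symmetric[OF P])
    then show ?thesis
      by (simp add: norm_eq_sqrt_cinner cinner_cadjoint[OF assms(3), symmetric])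
  qed
  \<comment> \<open>Hence every subspace on which \<open>T\<close> must be tested is also one on
    which \<open>op_abs T\<close> is tested.\<close>
  have "reduces M (op_abs T)" if M: "reduces M T" for M
  proof -
    have "reduces M (cadjoint T \<circ> T)"
      using M unfolding reduces_positive_op_iff[OF TT] by (auto simp: reduces_def)
    then show ?thesis using reduces_square_iff[OF P] PP by simp
  qed
  \<comment> \<open>Minimum modulus and attainment depend on an operator only through the norms of
    its values, so \<open>norm_eq\<close> transfers them.\<close>
  then have "op_abs T \<in> \<M>\<^sub>r \<longrightarrow> T \<in> \<M>\<^sub>r"
    using assms(3)
    by (auto simp: min_attaining_reducing_def minimum_attaining_on_def min_modulus_on_def norm_eq)
  then show ?thesis
    using positive_op_square_min_attaining_reducing_iff[OF P]
      positive_op_square_min_attaining_reducing_iff[of T] PP by simp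
qed

end
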